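(* Let $\mathcal X\subset\mathbb R^d$ be nonempty and closed, let $\ell:\mathcal X\times\Xi\to\mathbb R$, and let $\xi_1,\xi_2,\dots$ be i.i.d. with distribution $P_0$, with empirical distributions $\widehat P_n$. Let $f$ satisfy the smoothness assumption in the context and $\rho>0$. Assume there exist $Z:\Xi\to\mathbb R_+$ and $\epsilon>0$ with $|\ell(x;\xi)|\le Z(\xi)$ for all $x\in\mathcal X$ (and $\xi\in\Xi$) and $\mathbb E_{P_0}[Z(\xi)^{1+\epsilon}]<\infty$. Assume the class $\{\ell(x;\cdot):x\in\mathcal X\}$ is Glivenko–Cantelli. Then $$\sup_{x\in\mathcal X}\ \sup_{P\ll\widehat P_n}\Big\{\big|\mathbb E_P[\ell(x;\xi)]-\mathbb E_{P_0}[\ell(x;\xi)]\big|:D_f(P\|\widehat P_n)\le\tfrac\rho n\Big\}\to0$$ outer almost surely as $n\to\infty$.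
   Context: $(\Xi,\mathcal A,P_0)$ is a probability space with $\Xi$ a subset of a separable metric space; $\ell$ is lower semicontinuous and $\ell(x;\cdot)$ is measurable. Smoothness assumption on $f$: $f:[0,\infty)\to\mathbb R\cup\{+\infty\}$ is lower semicontinuous and convex, three times differentiable in a neighborhood of $1$, with $f(1)=f'(1)=0$ and $f''(1)=2$. For probability measures $P\ll Q$, $D_f(P\|Q)=\int f\!\left(\frac{dP}{dQ}\right)dQ$. A collection $\mathcal H$ of functions $h:\Xi\to\mathbb R$ is Glivenko–Cantelli if $\sup_{h\in\mathcal H}|\mathbb E_{\widehat P_n}[h]-\mathbb E_{P_0}[h]|\to0$ outer almost surely. Outer almost sure convergence is in the sense of van der Vaart and Wellner (there are measurable majorants converging to $0$ almost surely). *)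

theory Defs
  imports "HOL-Probability.Probability"
begin

(* At an isolated point of S the filter is bot and the Liminf is top, so the condition is void there. *)
definition lsc_on :: "'a::topological_space set \<Rightarrow> ('a \<Rightarrow> ereal) \<Rightarrow> bool" where
  "lsc_on S f \<longleftrightarrow> (\<forall>x\<in>S. f x \<le> Liminf (at x within S) f)"

(* The library's convex_on is for real-valued functions. As 0 * \<infinity> = 0 in ereal,
   the endpoints t = 0 and t = 1 are harmless. *)
definition ereal_convex_on :: "'a::real_vector set \<Rightarrow> ('a \<Rightarrow> ereal) \<Rightarrow> bool" where
  "ereal_convex_on S f \<longleftrightarrow> convex S \<and>
     (\<forall>x\<in>S. \<forall>y\<in>S. \<forall>t\<in>{0..1}.
        f ((1 - t) *\<^sub>R x + t *\<^sub>R y) \<le> ereal (1 - t) * f x + ereal t * f y)"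

(* The divergence generator f : [0,\<infinity>) -> R \<union> {\<infinity>} is represented by a function on all reals;
   its values at negative arguments are irrelevant. Near 1 it is finite, so that
   real_of_ereal \<circ> f is f itself there and the derivatives are the usual ones. *)
definition smooth_divergence_generator :: "(real \<Rightarrow> ereal) \<Rightarrow> bool" where
  "smooth_divergence_generator f \<longleftrightarrow>
     (\<forall>t\<ge>0. f t \<noteq> -\<infinity>) \<and> lsc_on {0..} f \<and> ereal_convex_on {0..} f \<and>
     (\<forall>\<^sub>F t in nhds 1. \<bar>f t\<bar> \<noteq> \<infinity> \<and>
        (\<forall>k<3. (deriv ^^ k) (real_of_ereal \<circ> f) differentiable (at t))) \<and>
     f 1 = 0 \<and> deriv (real_of_ereal \<circ> f) 1 = 0 \<and>
     (deriv ^^ 2) (real_of_ereal \<circ> f) 1 = 2"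

(* The integral of f (dP/dQ) with respect to Q as positive part minus negative part
   (e2ennreal maps negative numbers to 0); meaningful for P absolutely continuous w.r.t. Q. *)
definition f_divergence :: "(real \<Rightarrow> ereal) \<Rightarrow> 'b measure \<Rightarrow> 'b measure \<Rightarrow> ereal" where
  "f_divergence f P Q =
     enn2ereal (\<integral>\<^sup>+ z. e2ennreal (f (enn2real (RN_deriv Q P z))) \<partial>Q) -
     enn2ereal (\<integral>\<^sup>+ z. e2ennreal (- f (enn2real (RN_deriv Q P z))) \<partial>Q)"

definition f_divergence_ball :: "(real \<Rightarrow> ereal) \<Rightarrow> 'b measure \<Rightarrow> real \<Rightarrow> 'b measure set" where
  "f_divergence_ball f Q r =
     {P. prob_space P \<and> sets P = sets Q \<and> absolutely_continuous Q P \<and> f_divergence f P Q \<le> ereal r}"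

(* The n-th empirical distribution, built from the sample \<xi> 0, ..., \<xi> (n - 1), on the
   sigma-algebra of P0. For n = 0 this is the zero measure, which does not matter for limits. *)
definition empirical :: "'b measure \<Rightarrow> (nat \<Rightarrow> 'w \<Rightarrow> 'b) \<Rightarrow> nat \<Rightarrow> 'w \<Rightarrow> 'b measure" where
  "empirical P0 \<xi> n \<omega> = distr (uniform_count_measure {..<n}) P0 (\<lambda>i. \<xi> i \<omega>)"

(* Outer almost sure convergence to 0 of nonnegative, possibly non-measurable, extended-real-valued
   maps on the sample space: measurable majorants exist that converge to 0 almost surely. *)
definition outer_AE_tendsto_0 :: "'w measure \<Rightarrow> (nat \<Rightarrow> 'w \<Rightarrow> ennreal) \<Rightarrow> bool" where
  "outer_AE_tendsto_0 M X \<longleftrightarrow>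
     (\<exists>V. (\<forall>n. V n \<in> borel_measurable M) \<and> (\<forall>n. \<forall>\<omega>\<in>space M. X n \<omega> \<le> V n \<omega>) \<and>
          (AE \<omega> in M. (\<lambda>n. V n \<omega>) \<longlonglongrightarrow> 0))"

definition glivenko_cantelli ::
    "'w measure \<Rightarrow> 'b measure \<Rightarrow> (nat \<Rightarrow> 'w \<Rightarrow> 'b) \<Rightarrow> ('b \<Rightarrow> real) set \<Rightarrow> bool" where
  "glivenko_cantelli M P0 \<xi> H \<longleftrightarrow>
     outer_AE_tendsto_0 M
       (\<lambda>n \<omega>. SUP h\<in>H. ennreal \<bar>(\<integral>z. h z \<partial>empirical P0 \<xi> n \<omega>) - (\<integral>z. h z \<partial>P0)\<bar>)"

end

theory Submission
  imports Defs
begin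

text \<open>
  Since f is convex with f(1) = f'(1) = 0 and f''(1) = 2, it satisfies
  f(t) \<ge> c min((t - 1)^2, |t - 1|) for some c > 0. For P in the divergence ball around the
  empirical distribution, the likelihood ratios L_i at the n sample points thus have
  min((L_i - 1)^2, |L_i - 1|) summing to at most \<rho>/c, so the sum of (L_i - 1)^2 is bounded
  independently of n. By Cauchy-Schwarz, the expectations of loss x under P and under
  the empirical distribution differ, uniformly in x, by at most a constant times
  sqrt(Z_1^2 + ... + Z_n^2) / n. For 1 < p \<le> 2 with E[Z^p] finite this is at most
  (n^(-p) (Z_1^p + ... + Z_n^p))^(1/p). The series of Z_i^p / i^p has finite expectation, hence
  converges almost surely, and Kronecker's lemma gives the limit 0; no law of large numbers is
  needed. The remaining deviation is controlled by the Glivenko-Cantelli hypothesis.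
\<close>

section \<open>Growth of the divergence generator away from 1\<close>

text \<open>Close to 1 the second derivative 2 forces quadratic growth. Farther away
  \<open>f\<close> lies above its chords from 1 in the sense that a small value at \<open>t\<close>
  would, by convexity and \<open>f 1 = 0\<close>, force too small a value close to 1; this gives
  linear growth. The minimum joins both regimes under one constant.\<close>

lemma smooth_divergence_generator_growth:
  assumes "smooth_divergence_generator f"
  obtains c :: real where "c > 0"
    "\<And>t. t \<ge> 0 \<Longrightarrow> ereal (c * min ((t - 1)\<^sup>2) \<bar>t - 1\<bar>) \<le> f t"
proof -
  define F where "F = real_of_ereal \<circ> f"
  have ninf: "f t \<noteq> -\<infinity>" if "t \<ge> 0" for t
    using assms that by (auto simp: smooth_divergence_generator_def)
  have cvx: "f ((1 - u) *\<^sub>R x + u *\<^sub>R y) \<le> ereal (1 - u) * f x + ereal u * f y"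
    if "x \<ge> 0" "y \<ge> 0" "u \<in> {0..1}" for x y u
    using assms that by (auto simp: smooth_divergence_generator_def ereal_convex_on_def)
  have ev: "\<forall>\<^sub>F t in nhds 1. \<bar>f t\<bar> \<noteq> \<infinity> \<and> (\<forall>k<3. (deriv ^^ k) F differentiable (at t))"
    using assms by (simp add: smooth_divergence_generator_def F_def)
  have f1: "f 1 = 0" and dF1: "deriv F 1 = 0" and ddF1: "(deriv ^^ 2) F 1 = 2"
    using assms by (auto simp: smooth_divergence_generator_def F_def)
  have F1: "F 1 = 0" using f1 by (simp add: F_def)
  have "(deriv ^^ 1) F differentiable (at 1)"
    using eventually_nhds_x_imp_x[OF ev] by (metis one_less_numeral_iff semiring_norm(77))
  then have "(deriv F has_real_derivative 2) (at 1)"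
    using ddF1 by (simp add: real_differentiable_def eval_nat_numeral)
      (metis DERIV_imp_deriv)
  then have "((\<lambda>t. (deriv F t - deriv F 1) / (t - 1)) \<longlongrightarrow> 2) (at 1)"
    by (simp add: has_field_derivative_iff)
  \<comment> \<open>Any positive threshold below the limit 2 would serve; the choice 1 produces the
    factor 1/2 in \<open>local_bound\<close>.\<close>
  then have "\<forall>\<^sub>F t in at 1. (deriv F t - deriv F 1) / (t - 1) > 1"
    by (rule order_tendstoD) simp
  then have "\<forall>\<^sub>F t in nhds 1. t \<noteq> 1 \<longrightarrow> deriv F t / (t - 1) > 1"
    by (simp add: eventually_at_filter dF1)
  with ev have "\<forall>\<^sub>F t in nhds 1. (\<bar>f t\<bar> \<noteq> \<infinity> \<and> (\<forall>k<3. (deriv ^^ k) F differentiable (at t))) \<and>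
      (t \<noteq> 1 \<longrightarrow> deriv F t / (t - 1) > 1)"
    by (rule eventually_conj)
  then obtain d0 where d0: "d0 > 0" and near0: "\<And>t. dist t 1 < d0 \<Longrightarrow>
      (\<bar>f t\<bar> \<noteq> \<infinity> \<and> (\<forall>k<3. (deriv ^^ k) F differentiable (at t))) \<and>
      (t \<noteq> 1 \<longrightarrow> deriv F t / (t - 1) > 1)"
    unfolding eventually_nhds_metric by blast
  \<comment> \<open>Halving \<open>d0\<close> puts the closed interval of radius \<open>d\<close>
    inside the open ball of radius \<open>d0\<close>. The cap 1/2 makes \<open>d / 2\<close> smaller
    than the 1/2 of \<open>local_bound\<close>, so that \<open>d / 2\<close> serves as the final
    constant in both regimes.\<close>
  define d where "d = min (d0/2) (1/2)"
  have d: "d > 0" "d < 1" "d < d0" using d0 by (auto simp: d_def)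
  have fin: "f t = ereal (F t)" if "\<bar>t - 1\<bar> \<le> d" for t
    using near0[of t] that d by (auto simp: dist_real_def F_def ereal_real')
  have DF: "(F has_real_derivative deriv F t) (at t)" if "\<bar>t - 1\<bar> \<le> d" for t
  proof -
    have "(deriv ^^ 0) F differentiable (at t)"
      using near0[of t] that d by (metis dist_real_def le_less_trans zero_less_numeral)
    then show ?thesis
      using DERIV_imp_deriv by (auto simp: real_differentiable_def)
  qed
  have sgn: "t > 1 \<Longrightarrow> deriv F t \<ge> t - 1" "t < 1 \<Longrightarrow> deriv F t \<le> t - 1" if "\<bar>t - 1\<bar> \<le> d" for t
    using near0[of t] that d by (auto simp: dist_real_def field_simps)
  \<comment> \<open>By \<open>sgn\<close> the derivative of \<open>G\<close> is nonpositive to the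
    left of 1 and nonnegative to the right, so \<open>G\<close> is minimal at 1, where it
    vanishes.\<close>
  define G where "G = (\<lambda>t. F t - (t - 1)\<^sup>2 / 2)"
  have DG: "(G has_real_derivative (deriv F t - (t - 1))) (at t)" if "\<bar>t - 1\<bar> \<le> d" for t
    unfolding G_def by (auto intro!: derivative_eq_intros DF that simp: field_simps)
  have local_bound: "F t \<ge> (t - 1)\<^sup>2 / 2" if t: "\<bar>t - 1\<bar> \<le> d" for t
  proof (cases "t \<ge> 1")
    case True
    have "G 1 \<le> G t"
    proof (rule DERIV_nonneg_imp_nondecreasing[OF True])
      fix x assume "1 \<le> x" "x \<le> t"
      then have "\<bar>x - 1\<bar> \<le> d" using t by auto
      moreover from this have "deriv F x - (x - 1) \<ge> 0"
        using sgn(1)[of x] \<open>1 \<le> x\<close> dF1 by (cases "x = 1") auto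
      ultimately show "\<exists>y. DERIV G x :> y \<and> 0 \<le> y" using DG by blast
    qed
    then show ?thesis by (simp add: G_def F1)
  next
    case False
    have "G t \<ge> G 1"
    proof (rule DERIV_nonpos_imp_nonincreasing[of t 1 G])
      fix x assume "t \<le> x" "x \<le> 1"
      then have "\<bar>x - 1\<bar> \<le> d" using t by auto
      moreover from this have "deriv F x - (x - 1) \<le> 0"
        using sgn(2)[of x] \<open>x \<le> 1\<close> dF1 by (cases "x = 1") auto
      ultimately show "\<exists>y. DERIV G x :> y \<and> y \<le> 0" using DG by blast
    qed (use False in auto)
    then show ?thesis by (simp add: G_def F1)
  qed
  have far_bound: "ereal (d / 2 * \<bar>t - 1\<bar>) \<le> f t" if t: "\<bar>t - 1\<bar> > d" "t \<ge> 0" for t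
  proof (cases "f t")
    case (real r)
    \<comment> \<open>The weight \<open>u\<close> places \<open>s\<close>, on the segment from 1 to
      \<open>t\<close>, at distance exactly \<open>d\<close> from 1. There
      \<open>local_bound\<close> gives \<open>d\<^sup>2 / 2\<close>, while convexity gives at most
      \<open>u * r\<close>; cancelling \<open>u\<close> leaves the slope
      \<open>d / 2\<close>.\<close>
    define u where "u = d / \<bar>t - 1\<bar>"
    define s where "s = (1 - u) *\<^sub>R 1 + u *\<^sub>R t"
    have u: "u > 0" "u \<le> 1" "u * \<bar>t - 1\<bar> = d" using t d by (auto simp: u_def)
    have "s - 1 = u * (t - 1)" by (simp add: s_def algebra_simps)
    then have s: "\<bar>s - 1\<bar> = d" using u by (simp add: abs_mult)
    have "f s \<le> ereal (1 - u) * f 1 + ereal u * f t"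
      unfolding s_def using cvx[of 1 t u] u t by simp
    then have "F s \<le> u * r" using fin[of s] s f1 real by simp
    with local_bound[of s] s have "d\<^sup>2 / 2 \<le> u * r"
      by (metis order.trans order_refl power2_abs)
    then have "u * (d / 2 * \<bar>t - 1\<bar>) \<le> u * r"
      using u(3) by (simp add: power2_eq_square mult.commute mult.left_commute)
    then show ?thesis using u(1) real by simp
  qed (use ninf[of t] t in auto)
  show ?thesis
  proof (rule that[of "d / 2"])
    fix t :: real assume t: "t \<ge> 0"
    show "ereal (d / 2 * min ((t - 1)\<^sup>2) \<bar>t - 1\<bar>) \<le> f t"
    proof (cases "\<bar>t - 1\<bar> \<le> d")
      case True
      have "d / 2 * min ((t - 1)\<^sup>2) \<bar>t - 1\<bar> \<le> 1 / 2 * (t - 1)\<^sup>2"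
        using d by (intro mult_mono) auto
      with local_bound[OF True] fin[OF True] show ?thesis by simp
    next
      case False
      have "d / 2 * min ((t - 1)\<^sup>2) \<bar>t - 1\<bar> \<le> d / 2 * \<bar>t - 1\<bar>"
        using d by (intro mult_left_mono) auto
      then have "ereal (d / 2 * min ((t - 1)\<^sup>2) \<bar>t - 1\<bar>) \<le> ereal (d / 2 * \<bar>t - 1\<bar>)" by simp
      also have "\<dots> \<le> f t" using far_bound False t by auto
      finally show ?thesis .
    qed
  qed (use d in simp)
qed

section \<open>Kronecker's lemma and a comparison of power sums\<close>

text \<open>For nonnegative terms, dominated convergence for series (Tannery's theorem) replaces
  summation by parts: each single term vanishes in the limit and is dominated by the corresponding
  term of the convergent series.\<close>

lemma kronecker_nonneg:
  fixes b :: "nat \<Rightarrow> real"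
  assumes b: "\<And>i. b i \<ge> 0" and p: "p > 0"
    and sm: "summable (\<lambda>i. b i / real (Suc i) powr p)"
  shows "(\<lambda>n. (\<Sum>i<n. b i) / real n powr p) \<longlonglongrightarrow> 0"
proof -
  \<comment> \<open>Padding with zeros turns the partial sums of varying length into full series
    over \<open>k\<close>.\<close>
  define a where "a = (\<lambda>k n. if k < n then b k / real n powr p else 0)"
  have "(\<lambda>n. \<Sum>k. a k n) \<longlonglongrightarrow> (\<Sum>k::nat. 0)"
  proof (rule conjunct2[OF conjunct2[OF tannerys_theorem[OF _ _ sm]]])
    fix k
    have "(\<lambda>n. b k * real n powr - p) \<longlonglongrightarrow> 0"
      using p by (intro tendsto_mult_right_zero tendsto_neg_powr filterlim_real_sequentially) auto
    then have "(\<lambda>n. b k / real n powr p) \<longlonglongrightarrow> 0"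
      by (simp add: powr_minus divide_inverse)
    then show "(\<lambda>n. a k n) \<longlonglongrightarrow> 0"
    proof (rule Lim_transform_eventually)
      show "\<forall>\<^sub>F n in sequentially. b k / real n powr p = a k n"
        using eventually_gt_at_top[of k] by eventually_elim (simp add: a_def)
    qed
  next
    have "norm (a k n) \<le> b k / real (Suc k) powr p" for k n
    proof (cases "k < n")
      case True
      \<comment> \<open>The shift to \<open>Suc\<close> in the hypothesis fits exactly here:
        \<open>k < n\<close> means \<open>Suc k \<le> n\<close>.\<close>
      then have "real (Suc k) powr p \<le> real n powr p" using p by (intro powr_mono2) auto
      then show ?thesis using True b[of k] by (auto simp: a_def intro!: divide_left_mono)
    qed (use b[of k] in \<open>auto simp: a_def\<close>)
    then show "\<forall>\<^sub>F (k, n) in sequentially \<times>\<^sub>F sequentially.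
        norm (a k n) \<le> b k / real (Suc k) powr p"
      by (intro always_eventually) auto
  qed auto
  moreover have "(\<Sum>k. a k n) = (\<Sum>i<n. b i) / real n powr p" for n
    by (subst suminf_finite[of "{..<n}"]) (auto simp: a_def sum_divide_distrib)
  ultimately show ?thesis by simp
qed

text \<open>For \<open>p \<ge> 1\<close> this is the comparison of the l^2 norm with the l^p norm,
  squared. Each \<open>z i powr p\<close> is at most the whole sum \<open>S\<close>, so the surplus
  factor \<open>z i powr (2 - p)\<close> of the square is at most a power of
  \<open>S\<close>.\<close>

lemma sum_squares_le_powr_sum_powr:
  fixes z :: "'i \<Rightarrow> real"
  assumes z: "\<And>i. i \<in> I \<Longrightarrow> z i \<ge> 0" and p: "0 < p" "p \<le> 2" and fin: "finite I"
  shows "(\<Sum>i\<in>I. (z i)\<^sup>2) \<le> (\<Sum>i\<in>I. z i powr p) powr (2 / p)"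
proof -
  define S where "S = (\<Sum>i\<in>I. z i powr p)"
  have S: "S \<ge> 0" unfolding S_def by (intro sum_nonneg) auto
  have "(z i)\<^sup>2 \<le> z i powr p * S powr ((2 - p) / p)" if i: "i \<in> I" for i
  proof -
    have "z i powr p \<le> S" unfolding S_def by (rule member_le_sum[OF i]) (auto simp: fin)
    then have "(z i powr p) powr ((2 - p) / p) \<le> S powr ((2 - p) / p)"
      using p by (intro powr_mono2) auto
    then have "z i powr (2 - p) \<le> S powr ((2 - p) / p)" using p by (simp add: powr_powr)
    then have "z i powr p * z i powr (2 - p) \<le> z i powr p * S powr ((2 - p) / p)"
      by (intro mult_left_mono) auto
    moreover have "z i powr p * z i powr (2 - p) = (z i)\<^sup>2"
      using z[OF i] by (cases "z i = 0") (simp_all add: flip: powr_add)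
    ultimately show ?thesis by simp
  qed
  then have "(\<Sum>i\<in>I. (z i)\<^sup>2) \<le> S * S powr ((2 - p) / p)"
    unfolding S_def sum_distrib_right by (intro sum_mono)
  also have "\<dots> = S powr (2 / p)"
  proof (cases "S = 0")
    case False
    then have "S * S powr ((2 - p) / p) = S powr (1 + (2 - p) / p)" using S by (simp add: powr_add)
    also have "1 + (2 - p) / p = 2 / p" using p by (simp add: field_simps)
    finally show ?thesis .
  qed simp
  finally show ?thesis unfolding S_def .
qed

section \<open>Empirical integrals and deviation over a divergence ball\<close>

lemma nn_integral_empirical:
  assumes "\<And>i. i < n \<Longrightarrow> \<xi> i \<omega> \<in> space P0" "g \<in> borel_measurable P0"
  shows "(\<integral>\<^sup>+ z. g z \<partial>empirical P0 \<xi> n \<omega>) = (\<Sum>i<n. g (\<xi> i \<omega>) / of_nat n)"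
proof -
  have "(\<lambda>i. \<xi> i \<omega>) \<in> uniform_count_measure {..<n} \<rightarrow>\<^sub>M P0"
    using assms by (auto simp: measurable_def space_uniform_count_measure sets_uniform_count_measure)
  then show ?thesis
    using assms unfolding empirical_def
    by (simp add: nn_integral_distr uniform_count_measure_def nn_integral_point_measure_finite
        divide_ennreal_def inverse_ennreal ennreal_of_nat_eq_real_of_nat mult.commute divide_inverse)
qed

lemma integral_empirical:
  fixes g :: "'b \<Rightarrow> real"
  assumes "\<And>i. i < n \<Longrightarrow> \<xi> i \<omega> \<in> space P0" "g \<in> borel_measurable P0"
  shows "(\<integral>z. g z \<partial>empirical P0 \<xi> n \<omega>) = (\<Sum>i<n. g (\<xi> i \<omega>)) / real n"
proof -
  have "(\<lambda>i. \<xi> i \<omega>) \<in> uniform_count_measure {..<n} \<rightarrow>\<^sub>M P0"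
    using assms by (auto simp: measurable_def space_uniform_count_measure sets_uniform_count_measure)
  then show ?thesis
    using assms unfolding empirical_def by (simp add: integral_distr integral_uniform_count_measure)
qed

text \<open>With \<open>L\<close> the likelihood ratio, the difference of expectations is the
  empirical mean of \<open>(L - 1) * h\<close>, which Cauchy-Schwarz splits into a factor controlled
  by the divergence and one controlled by the envelope \<open>Z\<close>. The bound involves neither
  \<open>P\<close> nor \<open>h\<close>, hence is uniform over both.\<close>

lemma f_divergence_ball_empirical_deviation:
  fixes f :: "real \<Rightarrow> ereal" and h Z :: "'b \<Rightarrow> real"
  assumes c: "c > 0"
    and growth: "\<And>t. t \<ge> 0 \<Longrightarrow> ereal (c * min ((t - 1)\<^sup>2) \<bar>t - 1\<bar>) \<le> f t"
    and n: "n > 0" and \<rho>: "\<rho> \<ge> 0" and \<xi>: "\<And>i. i < n \<Longrightarrow> \<xi> i \<omega> \<in> space P0"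
    and P: "P \<in> f_divergence_ball f (empirical P0 \<xi> n \<omega>) (\<rho> / real n)"
    and h: "h \<in> borel_measurable P0" "\<And>z. z \<in> space P0 \<Longrightarrow> \<bar>h z\<bar> \<le> Z z"
  shows "\<bar>(\<integral>z. h z \<partial>P) - (\<integral>z. h z \<partial>empirical P0 \<xi> n \<omega>)\<bar>
    \<le> sqrt ((1 + \<rho> / c) * (\<rho> / c)) * (sqrt (\<Sum>i<n. (Z (\<xi> i \<omega>))\<^sup>2) / real n)"
proof -
  define Q where "Q = empirical P0 \<xi> n \<omega>"
  have sQ: "sets Q = sets P0" by (simp add: Q_def empirical_def)
  have mQ: "borel_measurable Q = (borel_measurable P0 :: ('b \<Rightarrow> real) set)"
    by (rule measurable_cong_sets[OF sQ refl])
  have nnQ: "(\<integral>\<^sup>+ z. g z \<partial>Q) = (\<Sum>i<n. g (\<xi> i \<omega>) / of_nat n)"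
    if "g \<in> borel_measurable P0" for g
    using that \<xi> unfolding Q_def by (intro nn_integral_empirical)
  have intQ: "(\<integral>z. g z \<partial>Q) = (\<Sum>i<n. g (\<xi> i \<omega>)) / real n"
    if "g \<in> borel_measurable P0" for g :: "'b \<Rightarrow> real"
    using that \<xi> unfolding Q_def by (intro integral_empirical)
  have "emeasure Q (space Q) = (\<integral>\<^sup>+ z. 1 \<partial>Q)" by simp
  also have "\<dots> \<noteq> \<infinity>"
    using n by (subst nnQ) (auto simp: ennreal_mult_eq_top_iff ennreal_divide_eq_top_iff)
  finally interpret Q: finite_measure Q by (intro finite_measureI)
  interpret P: prob_space P using P by (simp add: f_divergence_ball_def)
  have ac: "absolutely_continuous Q P" and sP: "sets P = sets Q"
    and div: "f_divergence f P Q \<le> ereal (\<rho> / n)"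
    using P by (auto simp: f_divergence_ball_def Q_def)
  define D where "D = RN_deriv Q P"
  define L where "L = (\<lambda>z. enn2real (D z))"
  have mD: "D \<in> borel_measurable Q" by (simp add: D_def)
  then have mL: "L \<in> borel_measurable Q" by (simp add: L_def)
  have L0: "L z \<ge> 0" for z by (simp add: L_def)
  \<comment> \<open>\<open>L\<close> sends infinite values of \<open>D\<close> to 0; this happens
    only on a null set, so the density is unchanged.\<close>
  have "AE z in Q. D z \<noteq> \<infinity>"
    unfolding D_def by (rule Q.RN_deriv_finite[OF P.sigma_finite_measure_axioms ac sP])
  then have "density Q (\<lambda>z. ennreal (L z)) = density Q D"
    using mD mL by (intro density_cong) (auto elim!: eventually_mono simp: L_def less_top)
  also have "\<dots> = P" unfolding D_def by (rule Q.density_RN_deriv[OF ac sP])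
  finally have "(\<integral>z. h z \<partial>P) = (\<integral>z. L z * h z \<partial>Q)"
    using integral_density[of h Q L] h(1) mL L0 by (simp add: mQ)
  also have "\<dots> = (\<Sum>i<n. L (\<xi> i \<omega>) * h (\<xi> i \<omega>)) / n"
    using h(1) mL by (intro intQ) (auto simp: mQ)
  finally have diff: "(\<integral>z. h z \<partial>P) - (\<integral>z. h z \<partial>Q) = (\<Sum>i<n. (L (\<xi> i \<omega>) - 1) * h (\<xi> i \<omega>)) / n"
    using intQ[OF h(1)] by (simp add: sum_subtractf diff_divide_distrib left_diff_distrib)
  define S where "S = (\<Sum>i<n. (Z (\<xi> i \<omega>))\<^sup>2)"
  define C where "C = (1 + \<rho> / c) * (\<rho> / c)"
  define m where "m = (\<lambda>t::real. min ((t - 1)\<^sup>2) \<bar>t - 1\<bar>)"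
  have m0: "m t \<ge> 0" for t by (simp add: m_def)
  \<comment> \<open>The growth bound makes \<open>f\<close> nonnegative, so the negative part in the
    divergence vanishes. The weight 1/n of each sample point cancels against the radius
    \<open>\<rho> / n\<close>, leaving a bound free of \<open>n\<close>.\<close>
  have sum_m: "(\<Sum>i<n. m (L (\<xi> i \<omega>))) \<le> \<rho> / c"
  proof -
    have f0: "f t \<ge> 0" if "t \<ge> 0" for t
      using order.trans[OF _ growth[OF that], of 0] c by simp
    have "(\<integral>\<^sup>+ z. e2ennreal (- f (L z)) \<partial>Q) = (\<integral>\<^sup>+ z. 0 \<partial>Q)"
      using f0[OF L0] by (intro nn_integral_cong e2ennreal_neg) simp
    with div have "enn2ereal (\<integral>\<^sup>+ z. e2ennreal (f (L z)) \<partial>Q) \<le> ereal (\<rho> / n)"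
      by (simp add: f_divergence_def L_def D_def zero_ennreal.rep_eq)
    then have "(\<integral>\<^sup>+ z. e2ennreal (f (L z)) \<partial>Q) \<le> ennreal (\<rho> / n)"
      by (metis e2ennreal_mono e2ennreal_enn2ereal e2ennreal_ereal)
    moreover have "(\<integral>\<^sup>+ z. ennreal (c * m (L z)) \<partial>Q) \<le> (\<integral>\<^sup>+ z. e2ennreal (f (L z)) \<partial>Q)"
      using e2ennreal_mono[OF growth[OF L0]]
      by (intro nn_integral_mono) (simp add: m_def e2ennreal_ereal)
    moreover have "(\<integral>\<^sup>+ z. ennreal (c * m (L z)) \<partial>Q)
        = (\<Sum>i<n. ennreal (c * m (L (\<xi> i \<omega>))) / of_nat n)"
      using mL unfolding m_def mQ by (intro nnQ) auto
    moreover have "\<dots> = ennreal (\<Sum>i<n. c * m (L (\<xi> i \<omega>)) / n)"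
      using n c m0 by (subst sum_ennreal[symmetric])
        (auto simp: divide_ennreal ennreal_of_nat_eq_real_of_nat)
    ultimately have "ennreal (\<Sum>i<n. c * m (L (\<xi> i \<omega>)) / n) \<le> ennreal (\<rho> / n)" by simp
    then have "(\<Sum>i<n. c * m (L (\<xi> i \<omega>)) / n) \<le> \<rho> / n" using \<rho> by simp
    then have "c * (\<Sum>i<n. m (L (\<xi> i \<omega>))) \<le> \<rho>"
      using n by (simp add: sum_distrib_left flip: sum_divide_distrib)
        (simp add: divide_le_cancel)
    then show ?thesis using c by (simp add: field_simps)
  qed
  \<comment> \<open>Ratios far from 1 enter \<open>m\<close> only linearly. The bound on the sum
    also bounds each term: if \<open>t > 1\<close> then \<open>t \<le> \<rho> / c\<close>, so
    \<open>t\<^sup>2\<close> is at most \<open>\<rho> / c\<close> times \<open>t\<close>. If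
    \<open>t \<le> 1\<close>, the minimum is already \<open>t\<^sup>2\<close>.\<close>
  have "(L (\<xi> i \<omega>) - 1)\<^sup>2 \<le> (1 + \<rho> / c) * m (L (\<xi> i \<omega>))" if i: "i < n" for i
  proof -
    define t where "t = \<bar>L (\<xi> i \<omega>) - 1\<bar>"
    have "m (L (\<xi> i \<omega>)) \<le> (\<Sum>i<n. m (L (\<xi> i \<omega>)))"
      using i m0 by (intro member_le_sum) auto
    then have mt: "min (t\<^sup>2) t \<le> \<rho> / c" using sum_m by (simp add: m_def t_def)
    have t0: "t \<ge> 0" by (simp add: t_def)
    have R0: "\<rho> / c \<ge> 0" using \<rho> c by simp
    have "t\<^sup>2 \<le> (1 + \<rho> / c) * min (t\<^sup>2) t"
    proof (cases "t \<le> 1")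
      case True
      then have "min (t\<^sup>2) t = t\<^sup>2"
        using t0 by (simp add: power2_eq_square mult_left_le)
      then show ?thesis using R0 mult_right_mono[of 1 "1 + \<rho> / c" "t\<^sup>2"] by simp
    next
      case False
      then have "min (t\<^sup>2) t = t" by (simp add: power2_eq_square min_def)
      then show ?thesis using mt t0 R0 by (auto simp: power2_eq_square intro!: mult_right_mono)
    qed
    then show ?thesis by (simp add: m_def t_def)
  qed
  then have "(\<Sum>i<n. (L (\<xi> i \<omega>) - 1)\<^sup>2) \<le> (\<Sum>i<n. (1 + \<rho> / c) * m (L (\<xi> i \<omega>)))"
    by (intro sum_mono) auto
  also have "\<dots> \<le> C"
    using sum_m c \<rho> unfolding sum_distrib_left[symmetric] C_def by (intro mult_left_mono) auto
  finally have sq: "(\<Sum>i<n. (L (\<xi> i \<omega>) - 1)\<^sup>2) \<le> C" .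
  have "\<bar>\<Sum>i<n. (L (\<xi> i \<omega>) - 1) * h (\<xi> i \<omega>)\<bar> \<le> sqrt (C * S)"
  proof (rule real_le_rsqrt)
    have "(\<Sum>i<n. (h (\<xi> i \<omega>))\<^sup>2) \<le> S"
      unfolding S_def using h(2)[OF \<xi>] by (intro sum_mono abs_le_square_iff[THEN iffD1]) force
    then have "(\<Sum>i<n. (L (\<xi> i \<omega>) - 1)\<^sup>2) * (\<Sum>i<n. (h (\<xi> i \<omega>))\<^sup>2) \<le> C * S"
      using sq by (intro mult_mono) (auto intro: sum_nonneg order.trans[OF sum_nonneg sq])
    then show "\<bar>\<Sum>i<n. (L (\<xi> i \<omega>) - 1) * h (\<xi> i \<omega>)\<bar>\<^sup>2 \<le> C * S"
      unfolding power2_abs by (rule order.trans[OF Cauchy_Schwarz_ineq_sum])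
  qed
  then have "\<bar>\<Sum>i<n. (L (\<xi> i \<omega>) - 1) * h (\<xi> i \<omega>)\<bar> / n \<le> sqrt C * sqrt S / n"
    by (intro divide_right_mono) (simp_all add: real_sqrt_mult)
  then have "\<bar>(\<integral>z. h z \<partial>P) - (\<integral>z. h z \<partial>Q)\<bar> \<le> sqrt C * (sqrt S / n)"
    by (simp add: diff)
  then show ?thesis by (simp only: Q_def C_def S_def)
qed

section \<open>Almost sure decay of the envelope term\<close>

text \<open>Expectation passes inside a nonnegative series, where every term contributes
  \<open>a i\<close> times the same integral of \<open>g\<close>. The series thus has finite
  expectation and is finite almost surely.\<close>

lemma AE_summable_identically_distributed:
  fixes g :: "'b \<Rightarrow> real" and a :: "nat \<Rightarrow> real"
  assumes \<xi>: "\<And>i. \<xi> i \<in> measurable M P0" "\<And>i. distr M P0 (\<xi> i) = P0"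
    and g: "integrable P0 g" "\<And>z. z \<in> space P0 \<Longrightarrow> g z \<ge> 0"
    and a: "summable a" "\<And>i. a i \<ge> 0"
  shows "AE \<omega> in M. summable (\<lambda>i. a i * g (\<xi> i \<omega>))"
proof -
  have [measurable]: "g \<in> borel_measurable P0" using g by auto
  note [measurable] = \<xi>(1)
  have gf: "(\<integral>\<^sup>+ z. ennreal (g z) \<partial>P0) = ennreal (integral\<^sup>L P0 g)"
    using g by (intro nn_integral_eq_integral) auto
  have "(\<integral>\<^sup>+ \<omega>. (\<Sum>i. ennreal (a i * g (\<xi> i \<omega>))) \<partial>M)
      = (\<Sum>i. \<integral>\<^sup>+ \<omega>. ennreal (a i) * ennreal (g (\<xi> i \<omega>)) \<partial>M)"
    using a by (subst nn_integral_suminf) (auto simp: ennreal_mult')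
  also have "\<dots> = (\<Sum>i. ennreal (a i) * (\<integral>\<^sup>+ z. ennreal (g z) \<partial>distr M P0 (\<xi> i)))"
    by (simp add: nn_integral_cmult nn_integral_distr)
  also have "\<dots> = (\<Sum>i. ennreal (a i)) * ennreal (integral\<^sup>L P0 g)"
    by (simp add: \<xi>(2) gf)
  also have "\<dots> < \<infinity>"
    using a by (simp add: suminf_ennreal2 ennreal_mult_less_top)
  finally have "AE \<omega> in M. (\<Sum>i. ennreal (a i * g (\<xi> i \<omega>))) \<noteq> \<infinity>"
    by (intro nn_integral_PInf_AE) auto
  then show ?thesis
  proof (rule AE_mp, intro AE_I2 impI)
    fix \<omega> assume "\<omega> \<in> space M" "(\<Sum>i. ennreal (a i * g (\<xi> i \<omega>))) \<noteq> \<infinity>"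
    moreover from this have "\<xi> i \<omega> \<in> space P0" for i using \<xi>(1) by (auto simp: measurable_def)
    ultimately show "summable (\<lambda>i. a i * g (\<xi> i \<omega>))"
      using a g by (intro summable_suminf_not_top) auto
  qed
qed

text \<open>The bound \<open>p > 1\<close> makes the weights \<open>real (Suc i) powr - p\<close>
  summable, so that Kronecker's lemma applies to the powers of \<open>Z\<close>; the bound
  \<open>p \<le> 2\<close> lets their sum control the sum of squares.\<close>

lemma AE_root_sum_squares_tendsto_0:
  fixes Z :: "'b \<Rightarrow> real"
  assumes \<xi>: "\<And>i. \<xi> i \<in> measurable M P0" "\<And>i. distr M P0 (\<xi> i) = P0"
    and Z: "\<And>z. z \<in> space P0 \<Longrightarrow> Z z \<ge> 0"
    and p: "1 < p" "p \<le> 2" and int: "integrable P0 (\<lambda>z. Z z powr p)"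
  shows "AE \<omega> in M. (\<lambda>n. sqrt (\<Sum>i<n. (Z (\<xi> i \<omega>))\<^sup>2) / real n) \<longlonglongrightarrow> 0"
proof -
  have "summable (\<lambda>i. real (Suc i) powr - p)"
    using p by (subst summable_Suc_iff) (simp add: summable_real_powr_iff)
  then have "AE \<omega> in M. summable (\<lambda>i. real (Suc i) powr - p * Z (\<xi> i \<omega>) powr p)"
    by (intro AE_summable_identically_distributed[OF \<xi> int]) auto
  then show ?thesis
  proof (rule AE_mp, intro AE_I2 impI)
    fix \<omega> assume \<omega>: "\<omega> \<in> space M"
      and sm: "summable (\<lambda>i. real (Suc i) powr - p * Z (\<xi> i \<omega>) powr p)"
    define S where "S = (\<lambda>n. \<Sum>i<n. Z (\<xi> i \<omega>) powr p)"
    have S0: "S n \<ge> 0" for n unfolding S_def by (intro sum_nonneg) auto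
    have Z0: "Z (\<xi> i \<omega>) \<ge> 0" for i using \<xi>(1) \<omega> Z by (auto simp: measurable_def)
    have "(\<lambda>n. S n / real n powr p) \<longlonglongrightarrow> 0"
      unfolding S_def using sm p
      by (intro kronecker_nonneg) (auto simp: powr_minus divide_inverse mult.commute)
    then have lim: "(\<lambda>n. (S n / real n powr p) powr (1 / p)) \<longlonglongrightarrow> 0"
      using p S0 by (intro tendsto_zero_powrI[where b="1/p"] tendsto_const) auto
    have bound: "sqrt (\<Sum>i<n. (Z (\<xi> i \<omega>))\<^sup>2) / real n \<le> (S n / real n powr p) powr (1 / p)" for n
    proof -
      have "sqrt (\<Sum>i<n. (Z (\<xi> i \<omega>))\<^sup>2) \<le> sqrt (S n powr (2 / p))"
        unfolding S_def using Z0 p by (intro real_sqrt_le_mono sum_squares_le_powr_sum_powr) auto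
      also have "\<dots> = S n powr (1 / p)"
        by (simp add: powr_half_sqrt[symmetric] powr_powr)
      finally have "sqrt (\<Sum>i<n. (Z (\<xi> i \<omega>))\<^sup>2) / real n \<le> S n powr (1 / p) / real n"
        by (intro divide_right_mono) auto
      \<comment> \<open>Moved inside the power \<open>1 / p\<close>, the factor 1/n becomes the
        normalisation \<open>real n powr p\<close> of Kronecker's lemma.\<close>
      also have "\<dots> = (S n / real n powr p) powr (1 / p)"
        using p S0 by (simp add: powr_divide powr_powr)
      finally show ?thesis .
    qed
    show "(\<lambda>n. sqrt (\<Sum>i<n. (Z (\<xi> i \<omega>))\<^sup>2) / real n) \<longlonglongrightarrow> 0"
      by (rule real_tendsto_sandwich[OF _ _ tendsto_const lim])
        (use bound in \<open>auto intro!: always_eventually sum_nonneg divide_nonneg_nonneg\<close>)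
  qed
qed

section \<open>Uniform convergence over the divergence balls\<close>

theorem theorem5:
  fixes M :: "'w measure"
    and P0 :: "'b::{metric_space, second_countable_topology} measure"
    and \<xi> :: "nat \<Rightarrow> 'w \<Rightarrow> 'b"
    and X :: "(real ^ 'd) set"
    and loss :: "real ^ 'd \<Rightarrow> 'b \<Rightarrow> real"
    and f :: "real \<Rightarrow> ereal"
    and Z :: "'b \<Rightarrow> real"
    and \<rho> \<epsilon> :: real
  assumes "prob_space M" and "prob_space P0"
    and "prob_space.indep_vars M (\<lambda>_. P0) \<xi> UNIV"
    and "\<And>i. distr M P0 (\<xi> i) = P0"
    and "X \<noteq> {}" and "closed X"
    and "lsc_on (X \<times> space P0) (\<lambda>(x, z). ereal (loss x z))"
    and "\<And>x. x \<in> X \<Longrightarrow> loss x \<in> borel_measurable P0"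
    and "smooth_divergence_generator f" and "\<rho> > 0"
    and "\<And>z. z \<in> space P0 \<Longrightarrow> Z z \<ge> 0" and "\<epsilon> > 0"
    and "\<And>x z. x \<in> X \<Longrightarrow> z \<in> space P0 \<Longrightarrow> \<bar>loss x z\<bar> \<le> Z z"
    and "integrable P0 (\<lambda>z. Z z powr (1 + \<epsilon>))"
    and "glivenko_cantelli M P0 \<xi> (loss ` X)"
  shows "outer_AE_tendsto_0 M
           (\<lambda>n \<omega>. SUP x\<in>X. SUP P\<in>f_divergence_ball f (empirical P0 \<xi> n \<omega>) (\<rho> / real n).
              ennreal \<bar>(\<integral>z. loss x z \<partial>P) - (\<integral>z. loss x z \<partial>P0)\<bar>)"
proof -
  note loss_meas = assms(8) and Z_nonneg = assms(11) and loss_le = assms(13) and Z_int = assms(14)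
  interpret M: prob_space M by fact
  interpret P0: prob_space P0 by fact
  have \<xi>: "\<xi> i \<in> measurable M P0" for i
    using assms(3) by (auto simp: M.indep_vars_def)
  then have \<xi>_space: "\<xi> i \<omega> \<in> space P0" if "\<omega> \<in> space M" for i \<omega>
    using that by (auto simp: measurable_def)
  \<comment> \<open>Measurability of \<open>Z\<close> is recovered from that of its integrable
    power, since taking the root inverts the power on nonnegative values.\<close>
  have "(\<lambda>z. (Z z powr (1 + \<epsilon>)) powr (1 / (1 + \<epsilon>))) \<in> borel_measurable P0"
    using borel_measurable_integrable[OF Z_int] by measurable
  also have "?this \<longleftrightarrow> Z \<in> borel_measurable P0"
    using Z_nonneg \<open>\<epsilon> > 0\<close> by (intro measurable_cong) (simp add: powr_powr)
  finally have Z_meas: "Z \<in> borel_measurable P0" .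
  \<comment> \<open>The exponent is capped at 2 for the comparison with squares and stays above 1.
    Integrability survives because \<open>Z z powr p\<close> is at most 1 where
    \<open>Z z < 1\<close> and at most \<open>Z z powr (1 + \<epsilon>)\<close> elsewhere.\<close>
  define p where "p = 1 + min \<epsilon> 1"
  have p: "1 < p" "p \<le> 2" "p \<le> 1 + \<epsilon>" using \<open>\<epsilon> > 0\<close> by (auto simp: p_def)
  have "integrable P0 (\<lambda>z. Z z powr p)"
  proof (rule Bochner_Integration.integrable_bound)
    show "integrable P0 (\<lambda>z. 1 + Z z powr (1 + \<epsilon>))" using Z_int by auto
    show "(\<lambda>z. Z z powr p) \<in> borel_measurable P0" using Z_meas by measurable
    show "AE z in P0. norm (Z z powr p) \<le> norm (1 + Z z powr (1 + \<epsilon>))"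
    proof (intro AE_I2)
      fix z assume z: "z \<in> space P0"
      show "norm (Z z powr p) \<le> norm (1 + Z z powr (1 + \<epsilon>))"
      proof (cases "Z z \<ge> 1")
        case True
        then show ?thesis using powr_mono[OF p(3) True] by simp
      next
        case False
        then have "Z z powr p \<le> 1 powr p" using Z_nonneg[OF z] p by (intro powr_mono2) auto
        then show ?thesis by (simp add: add_increasing2)
      qed
    qed
  qed
  then have root_lim: "AE \<omega> in M. (\<lambda>n. sqrt (\<Sum>i<n. (Z (\<xi> i \<omega>))\<^sup>2) / real n) \<longlonglongrightarrow> 0"
    using \<xi> assms(4) Z_nonneg p(1,2) by (intro AE_root_sum_squares_tendsto_0)
  obtain c where c: "c > 0"
    and growth: "\<And>t. t \<ge> 0 \<Longrightarrow> ereal (c * min ((t - 1)\<^sup>2) \<bar>t - 1\<bar>) \<le> f t"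
    using smooth_divergence_generator_growth[OF assms(9)] by blast
  obtain V where V: "\<And>n. V n \<in> borel_measurable M"
    "\<And>n \<omega>. \<omega> \<in> space M \<Longrightarrow>
      (SUP h\<in>loss ` X. ennreal \<bar>(\<integral>z. h z \<partial>empirical P0 \<xi> n \<omega>) - (\<integral>z. h z \<partial>P0)\<bar>) \<le> V n \<omega>"
    "AE \<omega> in M. (\<lambda>n. V n \<omega>) \<longlonglongrightarrow> 0"
    using assms(15) unfolding glivenko_cantelli_def outer_AE_tendsto_0_def by blast
  define K where "K = sqrt ((1 + \<rho> / c) * (\<rho> / c))"
  define B where "B = (\<lambda>n \<omega>. K * (sqrt (\<Sum>i<n. (Z (\<xi> i \<omega>))\<^sup>2) / real n))"
  have B_nonneg: "B n \<omega> \<ge> 0" for n \<omega>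
    unfolding B_def K_def using c \<open>\<rho> > 0\<close>
    by (intro mult_nonneg_nonneg divide_nonneg_nonneg real_sqrt_ge_zero sum_nonneg) auto
  \<comment> \<open>The supremum need not be measurable, but \<open>B n\<close> and the
    Glivenko-Cantelli majorant \<open>V n\<close> are. The value at \<open>n = 0\<close>, where the
    deviation bound does not apply, is a trivial majorant that leaves the limit unchanged.\<close>
  define W where "W = (\<lambda>n \<omega>. if n = 0 then \<top> else ennreal (B n \<omega>) + V n \<omega>)"
  show ?thesis
    unfolding outer_AE_tendsto_0_def
  proof (intro exI[of _ W] conjI allI ballI)
    fix n
    have "B n \<in> borel_measurable M"
      unfolding B_def using \<xi> Z_meas by measurable
    then show "W n \<in> borel_measurable M" using V(1)[of n] by (cases "n = 0") (auto simp: W_def)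
  next
    fix n \<omega> assume \<omega>: "\<omega> \<in> space M"
    show "(SUP x\<in>X. SUP P\<in>f_divergence_ball f (empirical P0 \<xi> n \<omega>) (\<rho> / real n).
              ennreal \<bar>(\<integral>z. loss x z \<partial>P) - (\<integral>z. loss x z \<partial>P0)\<bar>) \<le> W n \<omega>"
    proof (cases "n = 0")
      case False
      show ?thesis
      proof (intro SUP_least)
        fix x P
        assume x: "x \<in> X" and P: "P \<in> f_divergence_ball f (empirical P0 \<xi> n \<omega>) (\<rho> / real n)"
        let ?EQ = "\<integral>z. loss x z \<partial>empirical P0 \<xi> n \<omega>"
        \<comment> \<open>The empirical expectation is the intermediate point: \<open>B\<close>
          bounds the gap to \<open>P\<close> and \<open>V\<close> the gap to \<open>P0\<close>, both
          uniformly in \<open>x\<close>.\<close>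
        have "\<bar>(\<integral>z. loss x z \<partial>P) - (\<integral>z. loss x z \<partial>P0)\<bar>
            \<le> \<bar>(\<integral>z. loss x z \<partial>P) - ?EQ\<bar> + \<bar>?EQ - (\<integral>z. loss x z \<partial>P0)\<bar>" by linarith
        also have "\<bar>(\<integral>z. loss x z \<partial>P) - ?EQ\<bar> \<le> B n \<omega>"
          unfolding B_def K_def using False \<open>\<rho> > 0\<close> \<xi>_space[OF \<omega>] loss_meas[OF x] loss_le[OF x]
          by (intro f_divergence_ball_empirical_deviation[OF c growth _ _ _ P]) auto
        finally have "ennreal \<bar>(\<integral>z. loss x z \<partial>P) - (\<integral>z. loss x z \<partial>P0)\<bar>
            \<le> ennreal (B n \<omega> + \<bar>?EQ - (\<integral>z. loss x z \<partial>P0)\<bar>)" by (simp add: ennreal_leI)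
        also have "\<dots> \<le> ennreal (B n \<omega>) + ennreal \<bar>?EQ - (\<integral>z. loss x z \<partial>P0)\<bar>"
          by (subst ennreal_plus) (auto simp: B_nonneg)
        also have "ennreal \<bar>?EQ - (\<integral>z. loss x z \<partial>P0)\<bar> \<le> V n \<omega>"
          using V(2)[OF \<omega>, of n] x by (auto simp: SUP_le_iff)
        finally show "ennreal \<bar>(\<integral>z. loss x z \<partial>P) - (\<integral>z. loss x z \<partial>P0)\<bar> \<le> W n \<omega>"
          using False by (simp add: W_def add_left_mono)
      qed
    qed (simp add: W_def)
  next
    show "AE \<omega> in M. (\<lambda>n. W n \<omega>) \<longlonglongrightarrow> 0"
      using root_lim V(3)
    proof eventually_elim
      case (elim \<omega>)
      have "(\<lambda>n. ennreal (B n \<omega>) + V n \<omega>) \<longlonglongrightarrow> ennreal (K * 0) + 0"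
        unfolding B_def by (intro tendsto_add tendsto_ennrealI tendsto_mult tendsto_const elim)
      then have "(\<lambda>n. ennreal (B n \<omega>) + V n \<omega>) \<longlonglongrightarrow> 0" by simp
      then show ?case
      proof (rule Lim_transform_eventually)
        show "\<forall>\<^sub>F n in sequentially. ennreal (B n \<omega>) + V n \<omega> = W n \<omega>"
          using eventually_gt_at_top[of 0] by eventually_elim (simp add: W_def)
      qed
    qed
  qed
qed

end
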